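(* Let $n\ge4$ be an even integer, $r=\frac{n+2}{2}$ and $1\le k\le r-2$. Then $\mathcal{M}$ is a direct sum, that is, $$\mathcal{M}=\mathcal{L}_r\oplus\Bigg(\bigoplus_{k=1}^{r-2}\Big(\bigoplus_{\substack{1\le a_1<\cdots<a_{2k}\le 2n\\ a_i+a_j\neq 2n+1}}\mathcal{L}_{r-k}^{(a_1,\ldots,a_{2k})}\Big)\Bigg),$$ where $\mathcal{L}_{r-k}^{(a_1,\ldots,a_{2k})}$ is a copy of $\mathcal{L}_{r-k}$, for each $1\le k\le r-2$.
   Context: $I(\ell,m)=\{(\alpha_1,\ldots,\alpha_\ell)\in\mathbb{N}^\ell:1\le\alpha_1<\cdots<\alpha_\ell\le m\}$, whose elements are identified with their underlying sets. $C^a_b$ denotes the binomial coefficient. $\mathcal{M}$ is the $(0,1)$-matrix of order $C^{2n}_{n-2}\times C^{2n}_n$ with rows indexed by $\alpha\in I(n-2,2n)$ and columns indexed by $\beta\in I(n,2n)$, whose $(\alpha,\beta)$ entry is $1$ if $\beta=\alpha\cup\{i,2n-i+1\}$ for some $i$ with $|\alpha\cup\{i,2n-i+1\}|=n$, and $0$ otherwise (the authors do not specify orderings of these index sets). For $k\ge2$ and $m=2k-2$, $\mathcal{L}_k$ is the $(0,1)$-matrix whose rows are indexed by the $\frac{m-2}{2}$-element subsets and whose columns are indexed by the $\frac m2$-element subsets of an $m$-element set, both lexicographically ordered, with entry $1$ exactly when the row subset is contained in the column subset. The inner sum runs over all increasing sequences with $a_i+a_j\ne 2n+1$ for all $i,j$.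 $\oplus$ denotes the block-diagonal direct sum of matrices.
   Formalization: The displayed sum omits the 2^n zero columns of M (for n=4 it has 54 columns, M has 70); a summand with no rows and 2^n zero columns is added, and equality holds for suitable orderings of the rows and columns of M. *)

theory Defs
  imports
    "Jordan_Normal_Form.Matrix"
    "HOL-Library.List_Lexorder"
begin

text \<open>An element of $I(\ell,m)$ is the increasing list of its entries; \<open>set\<close> gives the
  underlying set.\<close>

definition index_seqs :: "nat \<Rightarrow> nat \<Rightarrow> nat list set" where
  "index_seqs l m = {\<alpha>. length \<alpha> = l \<and> sorted_wrt (<) \<alpha> \<and> set \<alpha> \<subseteq> {1..m}}"

lemma finite_index_seqs: "finite (index_seqs l m)"
  by (rule finite_subset[OF _ finite_lists_length_eq[of "{1..m}" l]])
     (auto simp: index_seqs_def)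

text \<open>A listing of \<open>A\<close> fixes an ordering of the rows or columns indexed by \<open>A\<close>.\<close>

definition is_listing :: "'b list \<Rightarrow> 'b set \<Rightarrow> bool" where
  "is_listing xs A \<longleftrightarrow> distinct xs \<and> set xs = A"

definition zero_one_mat ::
  "'b list \<Rightarrow> 'c list \<Rightarrow> ('b \<Rightarrow> 'c \<Rightarrow> bool) \<Rightarrow> 'a :: zero_neq_one mat" where
  "zero_one_mat rs cs P =
     mat (length rs) (length cs) (\<lambda>(i, j). if P (rs ! i) (cs ! j) then 1 else 0)"

text \<open>The matrix $\mathcal{M}$, relative to an ordering \<open>rs\<close> of $I(n-2,2n)$ and an ordering
  \<open>cs\<close> of $I(n,2n)$. The indices \<open>i\<close> and \<open>2 * n - i + 1\<close> are interchangeable, so \<open>i\<close> may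
  range over all of \<open>{1..2 * n}\<close>.\<close>

definition M_mat :: "nat \<Rightarrow> nat list list \<Rightarrow> nat list list \<Rightarrow> 'a :: zero_neq_one mat" where
  "M_mat n rs cs = zero_one_mat rs cs
     (\<lambda>\<alpha> \<beta>. \<exists>i\<in>{1..2 * n}. card (set \<alpha> \<union> {i, 2 * n - i + 1}) = n \<and>
        set \<beta> = set \<alpha> \<union> {i, 2 * n - i + 1})"

text \<open>The order on lists is that of \<open>HOL-Library.List_Lexorder\<close>, so \<open>sorted_list_of_set\<close> lists
  the index sequences lexicographically. Only $k \ge 2$ is meaningful.\<close>

definition L_mat :: "nat \<Rightarrow> 'a :: zero_neq_one mat" where
  "L_mat k = (let m = 2 * k - 2 in
     zero_one_mat
       (sorted_list_of_set (index_seqs ((m - 2) div 2) m))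
       (sorted_list_of_set (index_seqs (m div 2) m))
       (\<lambda>\<alpha> \<beta>. set \<alpha> \<subseteq> set \<beta>))"

text \<open>The elements of \<open>pair_free_seqs n n\<close> are the $2^n$ columns of $\mathcal{M}$ that contain no
  pair \<open>{i, 2 * n - i + 1}\<close>. They are zero columns, which no $\mathcal{L}_k$ with $k \ge 2$ has, so
  in a direct sum decomposition of $\mathcal{M}$ they form a separate block without rows.\<close>

definition pair_free_seqs :: "nat \<Rightarrow> nat \<Rightarrow> nat list set" where
  "pair_free_seqs n l =
     {a \<in> index_seqs l (2 * n). \<forall>i<l. \<forall>j<l. a ! i + a ! j \<noteq> 2 * n + 1}"

definition direct_sum :: "'i list \<Rightarrow> ('i \<Rightarrow> 'a :: zero mat) \<Rightarrow> 'a mat" where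
  "direct_sum is A = diag_block_mat (map A is)"

end

theory Submission
  imports Defs
begin

text \<open>Call \<open>{i, 2 * n + 1 - i}\<close> a pair. A subset of \<open>{1..2 * n}\<close> is determined by its unpaired
  part \<open>a\<close> and by the set of pairs that it contains, which can be any set of pairs not meeting
  \<open>a\<close>. An entry of $\mathcal{M}$ is $1$ exactly when the column arises from the row by adding a
  pair, which keeps the unpaired part; hence $\mathcal{M}$ splits into blocks indexed by the
  unpaired parts. If \<open>a\<close> has \<open>2 * k\<close> elements, then \<open>n - 2 * k\<close> pairs do not meet it, and its
  block is the inclusion matrix of sets of these pairs, that is, a copy of $\mathcal{L}_{r-k}$.\<close>

section \<open>Unpaired part and contained pairs of a set\<close>

definition unpaired :: "nat \<Rightarrow> nat set \<Rightarrow> nat set" where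
  "unpaired n X = {x \<in> X. 2 * n + 1 - x \<notin> X}"

text \<open>A pair is represented by its smaller element, which lies in \<open>{1..n}\<close>. Thus
  sets of pairs are subsets of \<open>{1..n}\<close>, here and in \<open>doubled\<close> and
  \<open>free_pairs\<close>.\<close>

definition pairs :: "nat \<Rightarrow> nat set \<Rightarrow> nat set" where
  "pairs n X = {i \<in> {1..n}. i \<in> X \<and> 2 * n + 1 - i \<in> X}"

definition doubled :: "nat \<Rightarrow> nat set \<Rightarrow> nat set" where
  "doubled n S = S \<union> (\<lambda>i. 2 * n + 1 - i) ` S"

definition free_pairs :: "nat \<Rightarrow> nat set \<Rightarrow> nat set" where
  "free_pairs n A = {i \<in> {1..n}. i \<notin> A \<and> 2 * n + 1 - i \<notin> A}"

lemma finite_free_pairs [simp]: "finite (free_pairs n A)"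
  by (simp add: free_pairs_def)

lemma pairs_subset: "pairs n X \<subseteq> {1..n}"
  by (auto simp: pairs_def)

lemma free_pairs_subset: "free_pairs n A \<subseteq> {1..n}"
  by (auto simp: free_pairs_def)

text \<open>The reflection \<open>i\<close> to \<open>2 * n + 1 - i\<close> is its own inverse on
  \<open>{1..2 * n}\<close>, so the image can be replaced by a condition on \<open>x\<close>
  itself.\<close>

lemma mem_doubled:
  assumes "S \<subseteq> {1..n}"
  shows "x \<in> doubled n S \<longleftrightarrow> x \<in> S \<or> (n < x \<and> x \<le> 2 * n \<and> 2 * n + 1 - x \<in> S)"
proof
  assume "x \<in> doubled n S"
  then show "x \<in> S \<or> (n < x \<and> x \<le> 2 * n \<and> 2 * n + 1 - x \<in> S)"
    using assms by (fastforce simp: doubled_def)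
next
  assume "x \<in> S \<or> (n < x \<and> x \<le> 2 * n \<and> 2 * n + 1 - x \<in> S)"
  then show "x \<in> doubled n S"
    unfolding doubled_def by (auto intro!: image_eqI[where x = "2 * n + 1 - x"])
qed

lemma doubled_subset: "S \<subseteq> {1..n} \<Longrightarrow> doubled n S \<subseteq> {1..2 * n}"
  by (force simp: doubled_def)

lemma card_doubled:
  assumes "S \<subseteq> {1..n}"
  shows "card (doubled n S) = 2 * card S"
proof -
  have fin: "finite S"
    using assms finite_subset by blast
  have "inj_on (\<lambda>i. 2 * n + 1 - i) S"
    using assms by (force intro!: inj_onI)
  \<comment> \<open>Two elements of \<open>{1..n}\<close> have sum at most \<open>2 * n\<close>, so
    \<open>S\<close> does not meet its mirror image.\<close>
  moreover have "x + y \<noteq> 2 * n + 1" if "x \<in> S" "y \<in> S" for x y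
    using subsetD[OF assms that(1)] subsetD[OF assms that(2)] by auto
  then have "S \<inter> (\<lambda>i. 2 * n + 1 - i) ` S = {}"
    using assms by fastforce
  ultimately show ?thesis
    unfolding doubled_def using fin by (simp add: card_Un_disjoint card_image)
qed

text \<open>One half of the bijection between sets \<open>X\<close> and pairs \<open>(A, S)\<close>
  with \<open>A\<close> pair-free and \<open>S\<close> a set of free pairs. The set
  \<open>doubled n S\<close> is closed under the reflection and disjoint from \<open>A\<close>, so
  its elements are exactly the paired ones of the union.\<close>

lemma
  assumes "unpaired n A = A" "A \<subseteq> {1..2 * n}" "S \<subseteq> free_pairs n A"
  shows unpaired_Un_doubled: "unpaired n (A \<union> doubled n S) = A"
    and pairs_Un_doubled: "pairs n (A \<union> doubled n S) = S"
    and card_Un_doubled: "card (A \<union> doubled n S) = card A + 2 * card S"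
proof -
  have S: "S \<subseteq> {1..n}"
    using assms(3) free_pairs_subset by blast
  have A: "1 \<le> x \<and> x \<le> 2 * n \<and> 2 * n + 1 - x \<notin> A" if "x \<in> A" for x
    using that assms(1,2) by (auto simp: unpaired_def)
  have free: "1 \<le> i \<and> i \<le> n \<and> i \<notin> A \<and> 2 * n + 1 - i \<notin> A" if "i \<in> S" for i
    using that assms(3) by (auto simp: free_pairs_def)
  have invol: "2 * n + 1 - (2 * n + 1 - x) = x" if "x \<le> 2 * n" for x
    using that by simp
  have disj: "x \<notin> doubled n S" if "x \<in> A" for x
    using free A[OF that] invol that by (metis mem_doubled[OF S])
  have D: "2 * n + 1 - x \<in> doubled n S \<longleftrightarrow> x \<in> doubled n S" if "1 \<le> x" "x \<le> 2 * n" for x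
    using that S by (auto simp: mem_doubled[OF S] Suc_diff_le)
  have D_bd: "1 \<le> x \<and> x \<le> 2 * n" if "x \<in> doubled n S" for x
    using that doubled_subset[OF S] by auto
  show "unpaired n (A \<union> doubled n S) = A"
  proof (intro Set.set_eqI)
    fix x
    show "x \<in> unpaired n (A \<union> doubled n S) \<longleftrightarrow> x \<in> A"
      unfolding unpaired_def using A D D_bd disj by blast
  qed
  show "pairs n (A \<union> doubled n S) = S"
  proof (intro Set.set_eqI)
    fix i
    show "i \<in> pairs n (A \<union> doubled n S) \<longleftrightarrow> i \<in> S"
    proof
      assume i: "i \<in> pairs n (A \<union> doubled n S)"
      then have bd: "1 \<le> i" "i \<le> n"
        by (auto simp: pairs_def)
      \<comment> \<open>If \<open>i\<close> were in \<open>A\<close>, its partner could only lie in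
        \<open>doubled n S\<close>; by closure under the reflection \<open>i\<close> would lie there
        too, against disjointness.\<close>
      have "i \<in> doubled n S"
        using i A D[of i] disj[of i] bd by (auto simp: pairs_def)
      then show "i \<in> S"
        using bd by (simp add: mem_doubled[OF S])
    next
      assume "i \<in> S"
      then show "i \<in> pairs n (A \<union> doubled n S)"
        using free[of i] by (auto simp: pairs_def doubled_def)
    qed
  qed
  have "finite A" "finite (doubled n S)"
    using assms(2) doubled_subset[OF S] finite_subset by blast+
  moreover have "A \<inter> doubled n S = {}"
    using disj by blast
  ultimately show "card (A \<union> doubled n S) = card A + 2 * card S"
    by (simp add: card_Un_disjoint card_doubled[OF S])
qed

text \<open>The other half of the bijection: every \<open>X\<close> splits into its unpaired part
  and the pairs it contains, and these pairs do not meet the unpaired part.\<close>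

lemma
  assumes "X \<subseteq> {1..2 * n}"
  shows unpaired_idem: "unpaired n (unpaired n X) = unpaired n X"
    and pairs_subset_free_pairs: "pairs n X \<subseteq> free_pairs n (unpaired n X)"
    and unpaired_Un_pairs: "unpaired n X \<union> doubled n (pairs n X) = X"
proof -
  have bd: "1 \<le> x" "x \<le> 2 * n" if "x \<in> X" for x
    using assms that by auto
  show "unpaired n (unpaired n X) = unpaired n X"
    by (auto simp: unpaired_def)
  show "pairs n X \<subseteq> free_pairs n (unpaired n X)"
    by (auto simp: pairs_def free_pairs_def unpaired_def)
  have "x \<in> doubled n (pairs n X) \<longleftrightarrow> x \<in> X \<and> 2 * n + 1 - x \<in> X" for x
  \<comment> \<open>The representative of the pair of \<open>x\<close> is \<open>x\<close> itself if
    \<open>x \<le> n\<close>, and its partner otherwise.\<close>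
  proof (cases "x \<le> n")
    case True
    then show ?thesis
      unfolding mem_doubled[OF pairs_subset] using bd[of x] by (auto simp: pairs_def)
  next
    case False
    then show ?thesis
      unfolding mem_doubled[OF pairs_subset] using bd[of x] bd[of "2 * n + 1 - x"]
      by (auto simp: pairs_def)
  qed
  then show "unpaired n X \<union> doubled n (pairs n X) = X"
    by (auto simp: unpaired_def)
qed

lemma card_eq_unpaired_pairs:
  assumes "X \<subseteq> {1..2 * n}"
  shows "card X = card (unpaired n X) + 2 * card (pairs n X)"
proof -
  have "unpaired n X \<subseteq> {1..2 * n}"
    using assms by (auto simp: unpaired_def)
  then show ?thesis
    using card_Un_doubled[OF unpaired_idem[OF assms] _ pairs_subset_free_pairs[OF assms]]
      unpaired_Un_pairs[OF assms] by simp
qed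

text \<open>A pair-free set contains at most one element of each pair, so it meets exactly
  \<open>card A\<close> of the \<open>n\<close> pairs.\<close>

lemma card_free_pairs:
  assumes "unpaired n A = A" "A \<subseteq> {1..2 * n}"
  shows "card (free_pairs n A) = n - card A"
proof -
  \<comment> \<open>\<open>f\<close> folds \<open>{1..2 * n}\<close> onto \<open>{1..n}\<close>,
    sending each element to the representative of its pair.\<close>
  define f where "f x = (if x \<le> n then x else 2 * n + 1 - x)" for x
  have A: "1 \<le> x \<and> x \<le> 2 * n \<and> 2 * n + 1 - x \<notin> A" if "x \<in> A" for x
    using that assms by (auto simp: unpaired_def)
  have inj: "inj_on f A"
  proof (rule inj_onI)
    fix x y assume xy: "x \<in> A" "y \<in> A" "f x = f y"
    then have "x = y \<or> y = 2 * n + 1 - x"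
      using A[of x] A[of y] by (auto simp: f_def split: if_splits)
    then show "x = y"
      using xy A[of x] by auto
  qed
  have "f ` A \<subseteq> {1..n}"
    using A by (fastforce simp: f_def)
  moreover have "free_pairs n A = {1..n} - f ` A"
  proof (intro Set.set_eqI iffI)
    fix i assume "i \<in> free_pairs n A"
    then show "i \<in> {1..n} - f ` A"
      using A by (auto simp: free_pairs_def f_def Suc_diff_le)
  next
    fix i assume i: "i \<in> {1..n} - f ` A"
    have "2 * n + 1 - i \<notin> A"
    proof
      assume "2 * n + 1 - i \<in> A"
      moreover have "f (2 * n + 1 - i) = i"
        using i by (auto simp: f_def)
      ultimately show False
        using i by force
    qed
    moreover have "i \<notin> A"
      using i by (force simp: f_def)
    ultimately show "i \<in> free_pairs n A"
      using i by (auto simp: free_pairs_def)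
  qed
  ultimately show ?thesis
    by (simp add: card_Diff_subset finite_subset card_image[OF inj])
qed

section \<open>The entries of \<open>M_mat\<close> in terms of pairs\<close>

lemma unpaired_insert_pair:
  assumes "i \<in> {1..2 * n}" "i \<notin> X" "2 * n + 1 - i \<notin> X" "X \<subseteq> {1..2 * n}"
  shows "unpaired n (X \<union> {i, 2 * n + 1 - i}) = unpaired n X"
proof (intro Set.set_eqI)
  fix x
  show "x \<in> unpaired n (X \<union> {i, 2 * n + 1 - i}) \<longleftrightarrow> x \<in> unpaired n X"
  proof (cases "x \<in> {1..2 * n}")
    case True
    then have "2 * n + 1 - x = i \<longleftrightarrow> x = 2 * n + 1 - i"
      and "2 * n + 1 - x = 2 * n + 1 - i \<longleftrightarrow> x = i"
      using assms(1) by auto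
    then show ?thesis
      using assms(2,3) by (auto simp: unpaired_def)
  next
    case False
    then show ?thesis
      using assms by (auto simp: unpaired_def)
  qed
qed

text \<open>From left to right, the added elements must both be new because the size rises by two,
  and a new pair leaves the unpaired part unchanged. From right to left, equal unpaired parts and
  sizes \<open>n - 2\<close> and \<open>n\<close> force \<open>Y\<close> to contain exactly one pair
  more than \<open>X\<close>.\<close>

lemma add_pair_iff:
  assumes X: "X \<subseteq> {1..2 * n}" "card X = n - 2" and Y: "Y \<subseteq> {1..2 * n}" "card Y = n"
    and n: "n \<ge> 2"
  shows "(\<exists>i\<in>{1..2 * n}. card (X \<union> {i, 2 * n - i + 1}) = n \<and> Y = X \<union> {i, 2 * n - i + 1})
    \<longleftrightarrow> unpaired n X = unpaired n Y \<and> pairs n X \<subseteq> pairs n Y"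
    (is "?L \<longleftrightarrow> ?R")
proof
  have finX: "finite X"
    using X finite_subset by blast
  assume ?L
  then obtain i where i: "i \<in> {1..2 * n}" and c: "card (X \<union> {i, 2 * n - i + 1}) = n"
    and Y_eq: "Y = X \<union> {i, 2 * n - i + 1}"
    by blast
  \<comment> \<open>With truncated subtraction the two forms of the partner agree because
    \<open>i \<le> 2 * n\<close>.\<close>
  have i': "2 * n - i + 1 = 2 * n + 1 - i"
    using i by auto
  have "card X + 2 \<le> card (X \<union> ({i, 2 * n - i + 1} - X))"
    using c X(2) n by simp
  also have "\<dots> = card X + card ({i, 2 * n - i + 1} - X)"
    using finX by (intro card_Un_disjoint) auto
  finally have c2: "2 \<le> card ({i, 2 * n - i + 1} - X)"
    by simp
  have notin: "i \<notin> X \<and> 2 * n - i + 1 \<notin> X"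
  proof (rule ccontr)
    assume "\<not> ?thesis"
    then have "{i, 2 * n - i + 1} - X \<subseteq> {i} \<or> {i, 2 * n - i + 1} - X \<subseteq> {2 * n - i + 1}"
      by blast
    then have "card ({i, 2 * n - i + 1} - X) \<le> 1"
      by (metis card.empty card_insert_disjoint card_mono empty_iff finite.emptyI finite_insert
          One_nat_def)
    with c2 show False
      by simp
  qed
  then show ?R
    using unpaired_insert_pair[OF i _ _ X(1)] i' by (auto simp: Y_eq pairs_def)
next
  assume R: ?R
  \<comment> \<open>Each pair contributes two elements, so the difference of two in size is one
    pair.\<close>
  have "card (pairs n Y) = card (pairs n X) + 1"
    using card_eq_unpaired_pairs[OF X(1)] card_eq_unpaired_pairs[OF Y(1)] R X Y n by auto
  then have "card (pairs n Y - pairs n X) = 1"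
    using R by (subst card_Diff_subset) (auto intro: finite_subset[OF pairs_subset])
  then obtain i where i: "pairs n Y - pairs n X = {i}"
    using card_1_singletonE by blast
  then have pY: "pairs n Y = insert i (pairs n X)"
    using R by blast
  have "1 \<le> i" "i \<le> n"
    using i pairs_subset[of n Y] by auto
  then have i': "i \<in> {1..2 * n}" "2 * n + 1 - i = 2 * n - i + 1"
    by auto
  have "Y = unpaired n X \<union> doubled n (insert i (pairs n X))"
    using unpaired_Un_pairs[OF Y(1)] R pY by simp
  also have "\<dots> = (unpaired n X \<union> doubled n (pairs n X)) \<union> {i, 2 * n - i + 1}"
    unfolding doubled_def i'(2)[symmetric] by blast
  also have "\<dots> = X \<union> {i, 2 * n - i + 1}"
    using unpaired_Un_pairs[OF X(1)] by simp
  finally show ?L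
    using i'(1) Y(2) by blast
qed

section \<open>Index sequences and pair-free sequences\<close>

lemma index_seqs_setD:
  assumes "a \<in> index_seqs l m"
  shows "set a \<subseteq> {1..m}" "card (set a) = l" "length a = l" "sorted_list_of_set (set a) = a"
  using assms
  by (auto simp: index_seqs_def strict_sorted_iff distinct_card
      sorted_list_of_set.idem_if_sorted_distinct)

lemma sorted_list_of_set_in_index_seqs:
  assumes "X \<subseteq> {1..m}" "card X = l"
  shows "sorted_list_of_set X \<in> index_seqs l m"
  using assms finite_subset[OF assms(1)] by (auto simp: index_seqs_def)

text \<open>Passes from positions in the sequence to its underlying set: for \<open>x\<close> in
  \<open>{1..2 * n}\<close>, \<open>x + y = 2 * n + 1\<close> says that \<open>y\<close> is the
  partner of \<open>x\<close>.\<close>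

lemma pair_free_seqs_conv: "pair_free_seqs n l = {a \<in> index_seqs l (2 * n). unpaired n (set a) = set a}"
proof -
  have "(\<forall>i<l. \<forall>j<l. a ! i + a ! j \<noteq> 2 * n + 1) \<longleftrightarrow> unpaired n (set a) = set a"
    if "a \<in> index_seqs l (2 * n)" for a
  proof -
    have "(\<forall>i<l. \<forall>j<l. a ! i + a ! j \<noteq> 2 * n + 1) \<longleftrightarrow> (\<forall>x\<in>set a. \<forall>y\<in>set a. x + y \<noteq> 2 * n + 1)"
      using index_seqs_setD(3)[OF that] by (simp add: all_set_conv_all_nth)
    also have "\<dots> \<longleftrightarrow> (\<forall>x\<in>set a. 2 * n + 1 - x \<notin> set a)"
    proof -
      have "x + y = 2 * n + 1 \<longleftrightarrow> y = 2 * n + 1 - x" if "x \<in> set a" for x y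
        using index_seqs_setD(1)[OF \<open>a \<in> _\<close>] that by auto
      then show ?thesis
        by metis
    qed
    also have "\<dots> \<longleftrightarrow> unpaired n (set a) = set a"
      by (auto simp: unpaired_def)
    finally show ?thesis .
  qed
  then show ?thesis
    by (auto simp: pair_free_seqs_def)
qed

lemma finite_pair_free_seqs [simp]: "finite (pair_free_seqs n l)"
  by (simp add: pair_free_seqs_def finite_index_seqs)

text \<open>A pair-free set with \<open>n\<close> elements chooses exactly one element from each of
  the \<open>n\<close> pairs, and these choices are independent. This counts the zero
  columns.\<close>

lemma card_pair_free_seqs: "card (pair_free_seqs n n) = 2 ^ n"
proof -
  let ?c = "\<lambda>i. 2 * n + 1 - i"
  \<comment> \<open>\<open>S\<close> collects the pairs from which the smaller element is chosen;
    \<open>g S\<close> takes the larger element of every other pair. Intersecting with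
    \<open>{1..n}\<close> recovers \<open>S\<close>.\<close>
  define g where "g S = S \<union> ?c ` ({1..n} - S)" for S
  have mem_g: "x \<in> g S \<longleftrightarrow> x \<in> S \<or> (n < x \<and> x \<le> 2 * n \<and> ?c x \<notin> S)"
    if S: "S \<subseteq> {1..n}" for S x
  proof
    assume "x \<in> g S"
    then show "x \<in> S \<or> (n < x \<and> x \<le> 2 * n \<and> ?c x \<notin> S)"
      by (auto simp: g_def)
  next
    assume "x \<in> S \<or> (n < x \<and> x \<le> 2 * n \<and> ?c x \<notin> S)"
    then show "x \<in> g S"
      unfolding g_def by (auto intro!: image_eqI[where x = "?c x"])
  qed
  have "bij_betw (\<lambda>S. sorted_list_of_set (g S)) (Pow {1..n}) (pair_free_seqs n n)"
  proof (rule bij_betw_byWitness[where f' = "\<lambda>a. set a \<inter> {1..n}"])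
    have fin: "finite (g S)" if "S \<subseteq> {1..n}" for S
      using that finite_subset by (auto simp: g_def)
    show "\<forall>S\<in>Pow {1..n}. set (sorted_list_of_set (g S)) \<inter> {1..n} = S"
      using fin by (auto simp: mem_g)
    show "(\<lambda>S. sorted_list_of_set (g S)) ` Pow {1..n} \<subseteq> pair_free_seqs n n"
    proof safe
      fix S assume S: "S \<subseteq> {1..n}"
      have "inj_on ?c ({1..n} - S)"
        by (force intro!: inj_onI)
      moreover have "S \<inter> ?c ` ({1..n} - S) = {}"
        using S by force
      ultimately have "card (g S) = n"
        using S finite_subset[OF S] card_mono[OF _ S] unfolding g_def
        by (simp add: card_Un_disjoint card_image card_Diff_subset)
      moreover have "g S \<subseteq> {1..2 * n}"
        using S by (auto simp: g_def)
      moreover have "?c x \<notin> g S" if "x \<in> g S" for x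
        using that subsetD[OF S, of x] subsetD[OF S, of "?c x"] by (auto simp: mem_g[OF S])
      then have "unpaired n (g S) = g S"
        by (auto simp: unpaired_def)
      ultimately show "sorted_list_of_set (g S) \<in> pair_free_seqs n n"
        using fin[OF S] by (simp add: pair_free_seqs_conv sorted_list_of_set_in_index_seqs)
    qed
    show "\<forall>a\<in>pair_free_seqs n n. sorted_list_of_set (g (set a \<inter> {1..n})) = a"
    proof
      fix a assume "a \<in> pair_free_seqs n n"
      then have a: "a \<in> index_seqs n (2 * n)" "unpaired n (set a) = set a"
        by (auto simp: pair_free_seqs_conv)
      note A = index_seqs_setD[OF a(1)]
      \<comment> \<open>The \<open>n\<close> elements meet \<open>n\<close> different pairs, so no
        pair is left out.\<close>
      have "free_pairs n (set a) = {}"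
        using card_free_pairs[OF a(2) A(1)] A(2) by simp
      then have free: "i \<in> set a \<or> ?c i \<in> set a" if "1 \<le> i" "i \<le> n" for i
        using that by (auto simp: free_pairs_def)
      have unp: "?c x \<notin> set a" if "x \<in> set a" for x
        using a(2) that by (auto simp: unpaired_def)
      have "g (set a \<inter> {1..n}) = set a"
      proof (intro Set.set_eqI)
        fix x
        show "x \<in> g (set a \<inter> {1..n}) \<longleftrightarrow> x \<in> set a"
          using A(1) free[of "?c x"] unp[of x] by (auto simp: mem_g)
      qed
      then show "sorted_list_of_set (g (set a \<inter> {1..n})) = a"
        using A(4) by simp
    qed
    show "(\<lambda>a. set a \<inter> {1..n}) ` pair_free_seqs n n \<subseteq> Pow {1..n}"
      by blast
  qed
  then show ?thesis
    by (simp add: bij_betw_same_card[symmetric] card_Pow)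
qed

section \<open>Index sequences with a given unpaired part\<close>

definition nth_free_pair :: "nat \<Rightarrow> nat list \<Rightarrow> nat \<Rightarrow> nat" where
  "nth_free_pair n a j = sorted_list_of_set (free_pairs n (set a)) ! (j - 1)"

text \<open>Translates an index \<open>\<gamma>\<close> of a small inclusion matrix into an index of
  $M$: the numbers in \<open>\<gamma>\<close> select free pairs of \<open>a\<close>, which are added
  to \<open>a\<close>.\<close>

definition add_pairs :: "nat \<Rightarrow> nat list \<Rightarrow> nat list \<Rightarrow> nat list" where
  "add_pairs n a \<gamma> = sorted_list_of_set (set a \<union> doubled n (nth_free_pair n a ` set \<gamma>))"

lemma bij_betw_nth_free_pair:
  assumes "a \<in> pair_free_seqs n l"
  shows "bij_betw (nth_free_pair n a) {1..n - l} (free_pairs n (set a))"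
proof -
  have a: "a \<in> index_seqs l (2 * n)" "unpaired n (set a) = set a"
    using assms by (auto simp: pair_free_seqs_conv)
  note A = index_seqs_setD[OF a(1)]
  let ?xs = "sorted_list_of_set (free_pairs n (set a))"
  have len: "length ?xs = n - l"
    using card_free_pairs[OF a(2) A(1)] A(2) by simp
  have "bij_betw ((!) ?xs) {..<n - l} (free_pairs n (set a))"
    by (rule bij_betw_nth) (simp_all add: len[simplified])
  \<comment> \<open>The ground set of the small inclusion matrix starts at 1, while positions in a
    list start at 0.\<close>
  moreover have "bij_betw (\<lambda>j. j - 1) {1..n - l} {..<n - l}"
    by (rule bij_betw_byWitness[where f' = Suc]) auto
  ultimately have "bij_betw ((!) ?xs \<circ> (\<lambda>j. j - 1)) {1..n - l} (free_pairs n (set a))"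
    by (rule bij_betw_trans[rotated])
  then show ?thesis
    by (simp add: o_def nth_free_pair_def[abs_def])
qed

lemma
  assumes a: "a \<in> pair_free_seqs n l" and \<gamma>: "\<gamma> \<in> index_seqs p (n - l)"
  shows add_pairs_in_index_seqs: "add_pairs n a \<gamma> \<in> index_seqs (l + 2 * p) (2 * n)"
    and unpaired_add_pairs: "unpaired n (set (add_pairs n a \<gamma>)) = set a"
    and pairs_add_pairs: "pairs n (set (add_pairs n a \<gamma>)) = nth_free_pair n a ` set \<gamma>"
proof -
  let ?S = "nth_free_pair n a ` set \<gamma>"
  have a': "a \<in> index_seqs l (2 * n)" "unpaired n (set a) = set a"
    using a by (auto simp: pair_free_seqs_conv)
  note A = index_seqs_setD[OF a'(1)] and G = index_seqs_setD[OF \<gamma>]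
  note bij = bij_betw_nth_free_pair[OF a]
  have S: "?S \<subseteq> free_pairs n (set a)"
    using bij G(1) by (auto simp: bij_betw_def)
  have "card ?S = p"
    using card_image[OF inj_on_subset[OF bij_betw_imp_inj_on[OF bij] G(1)]] G(2) by simp
  then have card: "card (set a \<union> doubled n ?S) = l + 2 * p"
    using card_Un_doubled[OF a'(2) A(1) S] A(2) by simp
  have sub: "set a \<union> doubled n ?S \<subseteq> {1..2 * n}"
    using doubled_subset[of ?S n] S free_pairs_subset[of n] A(1) by blast
  show "add_pairs n a \<gamma> \<in> index_seqs (l + 2 * p) (2 * n)"
    unfolding add_pairs_def by (rule sorted_list_of_set_in_index_seqs[OF sub card])
  have "set (add_pairs n a \<gamma>) = set a \<union> doubled n ?S"
    using finite_subset[OF sub] by (simp add: add_pairs_def)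
  then show "unpaired n (set (add_pairs n a \<gamma>)) = set a"
    and "pairs n (set (add_pairs n a \<gamma>)) = ?S"
    using unpaired_Un_doubled[OF a'(2) A(1) S] pairs_Un_doubled[OF a'(2) A(1) S] by simp_all
qed

lemma inj_on_add_pairs:
  assumes "a \<in> pair_free_seqs n l"
  shows "inj_on (add_pairs n a) (index_seqs p (n - l))"
proof (rule inj_onI)
  fix \<gamma> \<delta>
  assume \<gamma>: "\<gamma> \<in> index_seqs p (n - l)" and \<delta>: "\<delta> \<in> index_seqs p (n - l)"
    and eq: "add_pairs n a \<gamma> = add_pairs n a \<delta>"
  have "nth_free_pair n a ` set \<gamma> = nth_free_pair n a ` set \<delta>"
    using pairs_add_pairs[OF assms \<gamma>] pairs_add_pairs[OF assms \<delta>] eq by simp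
  then have "set \<gamma> = set \<delta>"
    using inj_on_image_eq_iff[OF bij_betw_imp_inj_on[OF bij_betw_nth_free_pair[OF assms]]]
      index_seqs_setD(1)[OF \<gamma>] index_seqs_setD(1)[OF \<delta>] by blast
  then show "\<gamma> = \<delta>"
    using index_seqs_setD(4)[OF \<gamma>] index_seqs_setD(4)[OF \<delta>] by metis
qed

text \<open>For surjectivity, a sequence of length \<open>l + 2 * p\<close> with unpaired part
  \<open>a\<close> contains exactly \<open>p\<close> pairs, all free for \<open>a\<close>. Their
  numbers among the free pairs form the preimage \<open>T\<close>.\<close>

lemma add_pairs_image:
  assumes a: "a \<in> pair_free_seqs n l"
  shows "add_pairs n a ` index_seqs p (n - l) =
    {\<beta> \<in> index_seqs (l + 2 * p) (2 * n). unpaired n (set \<beta>) = set a}" (is "_ = ?R")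
proof
  show "add_pairs n a ` index_seqs p (n - l) \<subseteq> ?R"
    using add_pairs_in_index_seqs[OF a] unpaired_add_pairs[OF a] by blast
  show "?R \<subseteq> add_pairs n a ` index_seqs p (n - l)"
  proof clarify
    fix \<beta> assume \<beta>: "\<beta> \<in> index_seqs (l + 2 * p) (2 * n)" and unp: "unpaired n (set \<beta>) = set a"
    note B = index_seqs_setD[OF \<beta>]
    note bij = bij_betw_nth_free_pair[OF a]
    let ?f = "nth_free_pair n a"
    have "pairs n (set \<beta>) \<subseteq> ?f ` {1..n - l}"
      using pairs_subset_free_pairs[OF B(1)] unp bij by (simp add: bij_betw_def)
    then obtain T where T: "T \<subseteq> {1..n - l}" "?f ` T = pairs n (set \<beta>)"
      by (metis subset_imageE)
    have "card (set a) = l"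
      using a index_seqs_setD(2) by (auto simp: pair_free_seqs_conv)
    then have "card (pairs n (set \<beta>)) = p"
      using card_eq_unpaired_pairs[OF B(1)] B(2) unp by simp
    then have "card T = p"
      using T card_image[OF inj_on_subset[OF bij_betw_imp_inj_on[OF bij] T(1)]] by simp
    then have "sorted_list_of_set T \<in> index_seqs p (n - l)"
      using T(1) by (rule sorted_list_of_set_in_index_seqs[rotated])
    moreover have "\<beta> = add_pairs n a (sorted_list_of_set T)"
      using finite_subset[OF T(1)] T(2) unpaired_Un_pairs[OF B(1)] unp B(4)
      by (simp add: add_pairs_def)
    ultimately show "\<beta> \<in> add_pairs n a ` index_seqs p (n - l)"
      by blast
  qed
qed

text \<open>The order is carried over from the lexicographic order of the small index sequences, so
  that a block of $M$ will equal \<open>L_mat\<close> entry by entry and not only up to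
  permutation.\<close>

definition fibre_list :: "nat \<Rightarrow> nat \<Rightarrow> nat list \<Rightarrow> nat list list" where
  "fibre_list n p a = map (add_pairs n a) (sorted_list_of_set (index_seqs p (n - length a)))"

lemma
  assumes "a \<in> pair_free_seqs n l"
  shows distinct_fibre_list: "distinct (fibre_list n p a)"
    and set_fibre_list: "set (fibre_list n p a) =
      {\<beta> \<in> index_seqs (l + 2 * p) (2 * n). unpaired n (set \<beta>) = set a}"
proof -
  have "length a = l"
    using assms index_seqs_setD(3) by (auto simp: pair_free_seqs_conv)
  then show "distinct (fibre_list n p a)" and "set (fibre_list n p a) =
      {\<beta> \<in> index_seqs (l + 2 * p) (2 * n). unpaired n (set \<beta>) = set a}"
    using inj_on_add_pairs[OF assms] add_pairs_image[OF assms]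
    by (simp_all add: fibre_list_def distinct_map finite_index_seqs)
qed

section \<open>Direct sums of zero-one matrices and the block of one unpaired part\<close>

lemma distinct_concat_map:
  assumes "distinct is" "\<And>i. i \<in> set is \<Longrightarrow> distinct (g i)"
    and "\<And>i x. i \<in> set is \<Longrightarrow> x \<in> set (g i) \<Longrightarrow> h x = i"
  shows "distinct (concat (map g is))"
  using assms
proof (induction "is")
  case (Cons i "is")
  have "set (g i) \<inter> set (concat (map g is)) = {}"
  proof (rule ccontr)
    assume "\<not> ?thesis"
    then obtain x j where "x \<in> set (g i)" "j \<in> set is" "x \<in> set (g j)"
      by auto
    then show False
      using Cons.prems(1) Cons.prems(3)[of i x] Cons.prems(3)[of j x] by auto
  qed
  moreover have "distinct (concat (map g is))"
    using Cons.prems by (intro Cons.IH) auto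
  ultimately show ?case
    using Cons.prems by simp
qed simp

lemma zero_one_mat_dim [simp]:
  "dim_row (zero_one_mat rs cs P) = length rs" "dim_col (zero_one_mat rs cs P) = length cs"
  by (simp_all add: zero_one_mat_def)

lemma zero_one_mat_no_rows: "zero_one_mat [] cs P = 0\<^sub>m 0 (length cs)"
  by (auto simp: zero_one_mat_def)

lemma zero_one_mat_map:
  assumes "\<And>x y. x \<in> set rs \<Longrightarrow> y \<in> set cs \<Longrightarrow> P (f x) (g y) \<longleftrightarrow> Q x y"
  shows "zero_one_mat (map f rs) (map g cs) P = zero_one_mat rs cs Q"
  using assms by (auto simp: zero_one_mat_def)

text \<open>The hypotheses on \<open>P\<close> make the two off-diagonal blocks zero. The lists may
  be empty, which covers a block without rows.\<close>

lemma diag_block_mat_Cons_zero_one_mat: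
  assumes "diag_block_mat As = zero_one_mat rs' cs' P"
    and "\<And>x y. x \<in> set rs \<Longrightarrow> y \<in> set cs' \<Longrightarrow> \<not> P x y"
    and "\<And>x y. x \<in> set rs' \<Longrightarrow> y \<in> set cs \<Longrightarrow> \<not> P x y"
  shows "diag_block_mat (zero_one_mat rs cs P # As) = zero_one_mat (rs @ rs') (cs @ cs') P"
  using assms(2,3)
  by (intro eq_matI) (auto simp: assms(1) Let_def zero_one_mat_def nth_append)

text \<open>The label \<open>h\<close> tells which block an index belongs to, and \<open>P\<close>
  only relates indices with equal labels, so everything off the diagonal blocks vanishes. It serves
  at two levels: with the unpaired part as label for fixed \<open>k\<close>, and with
  \<open>k\<close> as label.\<close>

lemma direct_sum_zero_one_mat:
  assumes "distinct is"
    and "\<And>i x. i \<in> set is \<Longrightarrow> x \<in> set (R i) \<Longrightarrow> h x = i"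
    and "\<And>i y. i \<in> set is \<Longrightarrow> y \<in> set (C i) \<Longrightarrow> h y = i"
    and "\<And>i j x y. \<lbrakk>i \<in> set is; j \<in> set is; x \<in> set (R i); y \<in> set (C j); P x y\<rbrakk> \<Longrightarrow> h x = h y"
  shows "(direct_sum is (\<lambda>i. zero_one_mat (R i) (C i) P) :: 'm :: zero_neq_one mat) =
    zero_one_mat (concat (map R is)) (concat (map C is)) P"
  using assms
proof (induction "is")
  case Nil
  show ?case
    by (simp add: direct_sum_def zero_one_mat_no_rows)
next
  case (Cons i "is")
  have IH: "(direct_sum is (\<lambda>i. zero_one_mat (R i) (C i) P) :: 'm mat) =
    zero_one_mat (concat (map R is)) (concat (map C is)) P"
  proof (rule Cons.IH)
    show "distinct is"
      using Cons.prems(1) by simp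
  qed (use Cons.prems(2-4) list.set_intros(2) in metis)+
  have off: "\<not> P x y" if "x \<in> set (R j)" "y \<in> set (C k)" "j \<in> set (i # is)" "k \<in> set (i # is)" "j \<noteq> k"
    for x y j k
    using Cons.prems(2)[OF that(3,1)] Cons.prems(3)[OF that(4,2)]
      Cons.prems(4)[OF that(3,4,1,2)] that(5) by auto
  show ?case
    unfolding direct_sum_def list.map concat.simps
  proof (rule diag_block_mat_Cons_zero_one_mat)
    show "(diag_block_mat (map (\<lambda>i. zero_one_mat (R i) (C i) P) is) :: 'm mat) =
      zero_one_mat (concat (map R is)) (concat (map C is)) P"
      using IH by (simp add: direct_sum_def)
    show "\<not> P x y" if "x \<in> set (R i)" "y \<in> set (concat (map C is))" for x y
      using that off[of x i y] Cons.prems(1) by auto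
    show "\<not> P x y" if "x \<in> set (concat (map R is))" "y \<in> set (C i)" for x y
      using that off[of x _ y i] Cons.prems(1) by auto
  qed
qed

text \<open>A pair-free \<open>a\<close> of length \<open>2 * k\<close> leaves
  \<open>n - 2 * k = 2 * (r - k) - 2\<close> free pairs, the size of the ground set of
  \<open>L_mat (r - k)\<close>. Rows add \<open>r - k - 2\<close> of them and columns
  \<open>r - k - 1\<close>; injectivity of the numbering turns inclusion of sets of pairs into
  inclusion of sets of numbers.\<close>

lemma zero_one_mat_fibre_list:
  assumes n: "n = 2 * r - 2" and k: "k + 2 \<le> r" and a: "a \<in> pair_free_seqs n (2 * k)"
    and P: "\<And>\<alpha> \<beta>. \<alpha> \<in> index_seqs (n - 2) (2 * n) \<Longrightarrow> \<beta> \<in> index_seqs n (2 * n) \<Longrightarrow>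
      P \<alpha> \<beta> \<longleftrightarrow> unpaired n (set \<alpha>) = unpaired n (set \<beta>) \<and> pairs n (set \<alpha>) \<subseteq> pairs n (set \<beta>)"
  shows "zero_one_mat (fibre_list n (r - k - 2) a) (fibre_list n (r - k - 1) a) P = L_mat (r - k)"
proof -
  have len: "length a = 2 * k"
    using a index_seqs_setD(3) by (auto simp: pair_free_seqs_conv)
  have m: "2 * (r - k) - 2 = n - 2 * k" "(n - 2 * k - 2) div 2 = r - k - 2"
    "(n - 2 * k) div 2 = r - k - 1" "2 * k + 2 * (r - k - 2) = n - 2" "2 * k + 2 * (r - k - 1) = n"
    using n k by auto
  note bij = bij_betw_nth_free_pair[OF a]
  show ?thesis
    unfolding fibre_list_def L_mat_def Let_def m(1,2,3) len
  proof (rule zero_one_mat_map)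
    fix \<gamma> \<delta>
    assume "\<gamma> \<in> set (sorted_list_of_set (index_seqs (r - k - 2) (n - 2 * k)))"
      and "\<delta> \<in> set (sorted_list_of_set (index_seqs (r - k - 1) (n - 2 * k)))"
    then have \<gamma>: "\<gamma> \<in> index_seqs (r - k - 2) (n - 2 * k)"
      and \<delta>: "\<delta> \<in> index_seqs (r - k - 1) (n - 2 * k)"
      by (simp_all add: finite_index_seqs)
    have "P (add_pairs n a \<gamma>) (add_pairs n a \<delta>) \<longleftrightarrow>
        nth_free_pair n a ` set \<gamma> \<subseteq> nth_free_pair n a ` set \<delta>"
      using P add_pairs_in_index_seqs[OF a \<gamma>] add_pairs_in_index_seqs[OF a \<delta>]
      unfolding m(4,5)
      by (simp add: unpaired_add_pairs[OF a \<gamma>] unpaired_add_pairs[OF a \<delta>]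
          pairs_add_pairs[OF a \<gamma>] pairs_add_pairs[OF a \<delta>])
    also have "\<dots> \<longleftrightarrow> set \<gamma> \<subseteq> set \<delta>"
      using bij_betw_imp_inj_on[OF bij] index_seqs_setD(1)[OF \<gamma>] index_seqs_setD(1)[OF \<delta>]
      unfolding inj_on_def by blast
    finally show "P (add_pairs n a \<gamma>) (add_pairs n a \<delta>) \<longleftrightarrow> set \<gamma> \<subseteq> set \<delta>" .
  qed
qed

text \<open>Pairs use up two elements each, so a set of even size has an unpaired part of even size.
  Applied to rows with \<open>q = r - 2\<close> and to columns with
  \<open>q = r - 1\<close>.\<close>

lemma fibre_exhaust:
  assumes "\<beta> \<in> index_seqs (2 * q) (2 * n)"
  obtains k a where "k \<le> q" "a \<in> pair_free_seqs n (2 * k)" "unpaired n (set \<beta>) = set a"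
proof -
  note B = index_seqs_setD[OF assms]
  have sub: "unpaired n (set \<beta>) \<subseteq> {1..2 * n}"
    using B(1) by (auto simp: unpaired_def)
  let ?k = "q - card (pairs n (set \<beta>))"
  have c: "card (unpaired n (set \<beta>)) = 2 * ?k"
    using card_eq_unpaired_pairs[OF B(1)] B(2) by simp
  have fin: "finite (unpaired n (set \<beta>))"
    by (simp add: unpaired_def)
  show ?thesis
  proof (rule that)
    show "?k \<le> q"
      by simp
    show "sorted_list_of_set (unpaired n (set \<beta>)) \<in> pair_free_seqs n (2 * ?k)"
      using sorted_list_of_set_in_index_seqs[OF sub c] unpaired_idem[OF B(1)] fin
      by (simp add: pair_free_seqs_conv)
    show "unpaired n (set \<beta>) = set (sorted_list_of_set (unpaired n (set \<beta>)))"
      using fin by simp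
  qed
qed

section \<open>The orderings of rows and columns and the assembly of the blocks\<close>

theorem theorem6p8:
  fixes n r :: nat
  assumes "n \<ge> 4" and "even n" and "r = (n + 2) div 2"
  shows "\<exists>rs cs.
    is_listing rs (index_seqs (n - 2) (2 * n)) \<and>
    is_listing cs (index_seqs n (2 * n)) \<and>
    (M_mat n rs cs :: 'a :: zero_neq_one mat) =
      diag_block_mat
        [L_mat r,
         direct_sum [1..<r - 1] (\<lambda>k.
           direct_sum (sorted_list_of_set (pair_free_seqs n (2 * k))) (\<lambda>a. L_mat (r - k))),
         0\<^sub>m 0 (2 ^ n)]"
proof -
  have n: "n = 2 * r - 2" and r: "r \<ge> 3"
    using assms by auto
  \<comment> \<open>\<open>F k\<close> lists the unpaired parts of size \<open>2 * k\<close>. Rows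
    and columns are grouped first by \<open>k\<close> and then by unpaired part.\<close>
  define F where "F k = sorted_list_of_set (pair_free_seqs n (2 * k))" for k
  define FR where "FR k = fibre_list n (r - k - 2)" for k
  define FC where "FC k = fibre_list n (r - k - 1)" for k
  define R where "R k = concat (map (FR k) (F k))" for k
  define C where "C k = concat (map (FC k) (F k))" for k
  \<comment> \<open>The labels of the two levels: \<open>u\<close> recovers the unpaired part and
    \<open>h\<close> the number \<open>k\<close>.\<close>
  define u where "u \<beta> = sorted_list_of_set (unpaired n (set \<beta>))" for \<beta>
  define h where "h \<beta> = card (unpaired n (set \<beta>)) div 2" for \<beta>
  define P where "P \<alpha> \<beta> \<longleftrightarrow> (\<exists>i\<in>{1..2 * n}. card (set \<alpha> \<union> {i, 2 * n - i + 1}) = n \<and>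
    set \<beta> = set \<alpha> \<union> {i, 2 * n - i + 1})" for \<alpha> \<beta>
  let ?rs = "R 0 @ concat (map R [1..<r - 1])"
  \<comment> \<open>The columns with \<open>k = r - 1\<close>, that is, \<open>2 * k = n\<close>. A
    row has only \<open>n - 2\<close> elements, so no row has this label.\<close>
  let ?Z = "sorted_list_of_set (pair_free_seqs n n)"
  let ?cs = "C 0 @ concat (map C [1..<r - 1]) @ ?Z"
  have P: "P \<alpha> \<beta> \<longleftrightarrow> unpaired n (set \<alpha>) = unpaired n (set \<beta>) \<and> pairs n (set \<alpha>) \<subseteq> pairs n (set \<beta>)"
    if "\<alpha> \<in> index_seqs (n - 2) (2 * n)" "\<beta> \<in> index_seqs n (2 * n)" for \<alpha> \<beta>
    unfolding P_def using add_pair_iff index_seqs_setD[OF that(1)] index_seqs_setD[OF that(2)] assms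
    by simp
  have F: "distinct (F k)" "set (F k) = pair_free_seqs n (2 * k)" for k
    by (simp_all add: F_def)
  have rows: "set (FR k a) = {\<beta> \<in> index_seqs (n - 2) (2 * n). unpaired n (set \<beta>) = set a}"
    and cols: "set (FC k a) = {\<beta> \<in> index_seqs n (2 * n). unpaired n (set \<beta>) = set a}"
    if "k + 2 \<le> r" "a \<in> set (F k)" for k a
  proof -
    have "2 * k + 2 * (r - k - 2) = n - 2" "2 * k + 2 * (r - k - 1) = n"
      using that(1) n by auto
    then show "set (FR k a) = {\<beta> \<in> index_seqs (n - 2) (2 * n). unpaired n (set \<beta>) = set a}"
      and "set (FC k a) = {\<beta> \<in> index_seqs n (2 * n). unpaired n (set \<beta>) = set a}"
      unfolding FR_def FC_def using set_fibre_list[of a n "2 * k"] that(2) by (simp_all only: F)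
  qed
  have u: "u \<beta> = a" if "unpaired n (set \<beta>) = set a" "a \<in> set (F k)" for \<beta> a k
    using that index_seqs_setD(4) by (auto simp: F u_def pair_free_seqs_conv)
  have h: "h \<beta> = k" if "unpaired n (set \<beta>) = set a" "a \<in> set (F k)" for \<beta> a k
    using that index_seqs_setD(2) by (auto simp: F h_def pair_free_seqs_conv)
  have R: "\<beta> \<in> index_seqs (n - 2) (2 * n) \<and> h \<beta> = k" if "k + 2 \<le> r" "\<beta> \<in> set (R k)" for \<beta> k
    using that(2) h rows[OF that(1)] by (auto simp: R_def)
  have C: "\<beta> \<in> index_seqs n (2 * n) \<and> h \<beta> = k" if "k + 2 \<le> r" "\<beta> \<in> set (C k)" for \<beta> k
    using that(2) h cols[OF that(1)] by (auto simp: C_def)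
  have Z: "\<beta> \<in> index_seqs n (2 * n) \<and> h \<beta> = r - 1" if "\<beta> \<in> set ?Z" for \<beta>
  proof -
    have \<beta>: "\<beta> \<in> index_seqs n (2 * n)" "unpaired n (set \<beta>) = set \<beta>"
      using that by (simp_all add: pair_free_seqs_conv finite_index_seqs)
    then show ?thesis
      using index_seqs_setD(2)[OF \<beta>(1)] n by (simp add: h_def)
  qed
  have dR: "distinct (R k)" if "k + 2 \<le> r" for k
  proof (unfold R_def, rule distinct_concat_map[where h = u])
    show "distinct (FR k a)" if "a \<in> set (F k)" for a
      using that unfolding FR_def by (auto simp: F intro: distinct_fibre_list)
    show "u \<beta> = a" if "a \<in> set (F k)" "\<beta> \<in> set (FR k a)" for a \<beta>
      using that u rows[OF \<open>k + 2 \<le> r\<close>] by blast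
  qed (rule F)
  have dC: "distinct (C k)" if "k + 2 \<le> r" for k
  proof (unfold C_def, rule distinct_concat_map[where h = u])
    show "distinct (FC k a)" if "a \<in> set (F k)" for a
      using that unfolding FC_def by (auto simp: F intro: distinct_fibre_list)
    show "u \<beta> = a" if "a \<in> set (F k)" "\<beta> \<in> set (FC k a)" for a \<beta>
      using that u cols[OF \<open>k + 2 \<le> r\<close>] by blast
  qed (rule F)
  have range: "k + 2 \<le> r" if "k \<in> set [m..<r - 1]" for k m
    using that by auto
  \<comment> \<open>The group \<open>k = 0\<close> stands apart in the claim because it gives
    \<open>L_mat r\<close>; here it joins the others, so that the range \<open>0..r - 2\<close> is
    treated uniformly.\<close>
  have rs_eq: "?rs = concat (map R [0..<r - 1])"
    and cs_eq: "?cs = concat (map C [0..<r - 1]) @ ?Z"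
    using r by (simp_all add: upt_conv_Cons)

  \<comment> \<open>Repetition inside a group is excluded by \<open>dR\<close>, and between groups
    by the label \<open>h\<close>.\<close>
  have "distinct ?rs"
    unfolding rs_eq using R dR range by (intro distinct_concat_map[where h = h] distinct_upt) blast+
  moreover have "set ?rs = index_seqs (n - 2) (2 * n)"
  proof
    show "set ?rs \<subseteq> index_seqs (n - 2) (2 * n)"
      unfolding rs_eq set_concat set_map using R range by blast
    show "index_seqs (n - 2) (2 * n) \<subseteq> set ?rs"
    proof
      fix \<beta> assume \<beta>: "\<beta> \<in> index_seqs (n - 2) (2 * n)"
      have "2 * (r - 2) = n - 2"
        using n by simp
      then obtain k a where ka: "k \<le> r - 2" "a \<in> set (F k)" "unpaired n (set \<beta>) = set a"
        using fibre_exhaust[of \<beta> "r - 2" n] \<beta> by (metis F(2))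
      have "k + 2 \<le> r"
        using ka(1) r by simp
      then have "\<beta> \<in> set (FR k a)"
        using rows ka \<beta> by blast
      then have "\<beta> \<in> set (R k)"
        using ka(2) by (auto simp: R_def)
      then show "\<beta> \<in> set ?rs"
        unfolding rs_eq set_concat set_map set_upt using \<open>k + 2 \<le> r\<close>
        by (intro UnionI[OF imageI[OF imageI[of k]]]) simp_all
    qed
  qed
  ultimately have rs: "is_listing ?rs (index_seqs (n - 2) (2 * n))"
    by (simp add: is_listing_def)

  have "distinct (concat (map C [0..<r - 1]))"
    using C dC range by (intro distinct_concat_map[where h = h] distinct_upt) blast+
  moreover have "set (concat (map C [0..<r - 1])) \<inter> set ?Z = {}"
  proof (rule ccontr)
    assume "\<not> ?thesis"
    then obtain \<beta> k where "k + 1 < r" "\<beta> \<in> set (C k)" "\<beta> \<in> set ?Z"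
      by (auto simp: less_diff_conv)
    then show False
      using C[of k \<beta>] Z[of \<beta>] by auto
  qed
  ultimately have "distinct ?cs"
    unfolding cs_eq distinct_append by simp
  moreover have "set ?cs = index_seqs n (2 * n)"
  proof
    show "set ?cs \<subseteq> index_seqs n (2 * n)"
      unfolding cs_eq set_append set_concat set_map using C Z range by blast
    show "index_seqs n (2 * n) \<subseteq> set ?cs"
    proof
      fix \<beta> assume \<beta>: "\<beta> \<in> index_seqs n (2 * n)"
      have n': "2 * (r - 1) = n"
        using n by simp
      then obtain k a where ka: "k \<le> r - 1" "a \<in> set (F k)" "unpaired n (set \<beta>) = set a"
        using fibre_exhaust[of \<beta> "r - 1" n] \<beta> by (metis F(2))
      show "\<beta> \<in> set ?cs"
      \<comment> \<open>For \<open>k = r - 1\<close> the unpaired part has \<open>n\<close> elements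
        and is therefore all of \<open>\<beta>\<close>, which puts \<open>\<beta>\<close> among the
        zero columns.\<close>
      proof (cases "k = r - 1")
        case True
        then have "card (unpaired n (set \<beta>)) = n"
          using ka(2,3) index_seqs_setD(2)[of a n "2 * n"] n' by (simp add: F pair_free_seqs_conv)
        moreover have "unpaired n (set \<beta>) \<subseteq> set \<beta>"
          by (auto simp: unpaired_def)
        ultimately have "unpaired n (set \<beta>) = set \<beta>"
          using index_seqs_setD(2)[OF \<beta>] by (simp add: card_subset_eq)
        then show ?thesis
          using \<beta> by (simp add: pair_free_seqs_conv finite_index_seqs)
      next
        case False
        then have "k + 2 \<le> r"
          using ka(1) r by simp
        then have "\<beta> \<in> set (FC k a)"
          using cols ka \<beta> by blast
        then have "\<beta> \<in> set (C k)"
          using ka(2) by (auto simp: C_def)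
        then show ?thesis
          unfolding cs_eq set_append set_concat set_map set_upt using \<open>k + 2 \<le> r\<close>
          by (intro UnI1 UnionI[OF imageI[OF imageI[of k]]]) simp_all
      qed
    qed
  qed
  ultimately have cs: "is_listing ?cs (index_seqs n (2 * n))"
    by (simp add: is_listing_def)

  \<comment> \<open>A nonzero entry keeps the unpaired part, hence also its size.\<close>
  have off: "h \<alpha> = h \<beta>"
    if "P \<alpha> \<beta>" "\<alpha> \<in> index_seqs (n - 2) (2 * n)" "\<beta> \<in> index_seqs n (2 * n)" for \<alpha> \<beta>
    using P[OF that(2,3)] that(1) by (simp add: h_def)
  have block: "(direct_sum (F k) (\<lambda>a. L_mat (r - k)) :: 'a mat) = zero_one_mat (R k) (C k) P"
    if k: "k + 2 \<le> r" for k
  proof -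
    have "(direct_sum (F k) (\<lambda>a. L_mat (r - k)) :: 'a mat) =
      direct_sum (F k) (\<lambda>a. zero_one_mat (FR k a) (FC k a) P)"
      unfolding direct_sum_def FR_def FC_def
    proof (rule arg_cong[where f = diag_block_mat], rule map_cong[OF refl])
      show "L_mat (r - k) =
          (zero_one_mat (fibre_list n (r - k - 2) a) (fibre_list n (r - k - 1) a) P :: 'a mat)"
        if "a \<in> set (F k)" for a
        using zero_one_mat_fibre_list[OF n k _ P, symmetric] that unfolding F by blast
    qed
    also have "\<dots> = zero_one_mat (R k) (C k) P"
      unfolding R_def C_def
    proof (rule direct_sum_zero_one_mat[where h = u])
      fix a b \<alpha> \<beta>
      assume "a \<in> set (F k)" "b \<in> set (F k)" "\<alpha> \<in> set (FR k a)" "\<beta> \<in> set (FC k b)" "P \<alpha> \<beta>"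
      then show "u \<alpha> = u \<beta>"
        using P[of \<alpha> \<beta>] rows[OF k] cols[OF k] by (simp add: u_def)
    next
      show "u \<alpha> = a" if "a \<in> set (F k)" "\<alpha> \<in> set (FR k a)" for a \<alpha>
        using that rows[OF k] u by blast
      show "u \<beta> = a" if "a \<in> set (F k)" "\<beta> \<in> set (FC k a)" for a \<beta>
        using that cols[OF k] u by blast
    qed (rule F)
    finally show ?thesis .
  qed
  \<comment> \<open>For \<open>k = 0\<close> the empty sequence is the only unpaired part, so the
    group is the single block \<open>L_mat r\<close>.\<close>
  have "pair_free_seqs n 0 = {[]}"
    by (auto simp: pair_free_seqs_def index_seqs_def)
  then have F0: "F 0 = [[]]"
    by (simp add: F_def)
  have first: "(L_mat r :: 'a mat) = zero_one_mat (R 0) (C 0) P"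
    unfolding R_def C_def F0 FR_def FC_def
    using zero_one_mat_fibre_list[OF n _ _ P, of 0 "[]", symmetric] r
      \<open>pair_free_seqs n 0 = {[]}\<close> by simp
  have mid: "(direct_sum [1..<r - 1] (\<lambda>k. direct_sum (F k) (\<lambda>a. L_mat (r - k))) :: 'a mat) =
    zero_one_mat (concat (map R [1..<r - 1])) (concat (map C [1..<r - 1])) P" (is "?D = _")
  proof -
    have "?D = direct_sum [1..<r - 1] (\<lambda>k. zero_one_mat (R k) (C k) P)"
      unfolding direct_sum_def[of "[1..<r - 1]"]
    proof (rule arg_cong[where f = diag_block_mat], rule map_cong[OF refl])
      show "direct_sum (F k) (\<lambda>a. L_mat (r - k)) = (zero_one_mat (R k) (C k) P :: 'a mat)"
        if "k \<in> set [1..<r - 1]" for k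
        using block range[OF that] by blast
    qed
    also have "\<dots> = zero_one_mat (concat (map R [1..<r - 1])) (concat (map C [1..<r - 1])) P"
    proof (rule direct_sum_zero_one_mat[where h = h])
      fix i j \<alpha> \<beta>
      assume "i \<in> set [1..<r - 1]" "j \<in> set [1..<r - 1]" "\<alpha> \<in> set (R i)" "\<beta> \<in> set (C j)" "P \<alpha> \<beta>"
      then show "h \<alpha> = h \<beta>"
        using off R C range by blast
    next
      show "h \<alpha> = k" if "k \<in> set [1..<r - 1]" "\<alpha> \<in> set (R k)" for k \<alpha>
        using that R range by blast
      show "h \<beta> = k" if "k \<in> set [1..<r - 1]" "\<beta> \<in> set (C k)" for k \<beta>
        using that C range by blast
    qed (rule distinct_upt)
    finally show ?thesis .
  qed
  \<comment> \<open>The block without rows has one column for each of the \<open>2 ^ n\<close>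
    pair-free sequences of length \<open>n\<close>.\<close>
  have last: "(0\<^sub>m 0 (2 ^ n) :: 'a mat) = zero_one_mat [] ?Z P"
    by (simp add: zero_one_mat_no_rows card_pair_free_seqs)
  have empty: "diag_block_mat [] = (zero_one_mat [] [] P :: 'a mat)"
    by (simp add: zero_one_mat_no_rows)
  have tail: "diag_block_mat [zero_one_mat (concat (map R [1..<r - 1])) (concat (map C [1..<r - 1])) P,
      zero_one_mat [] ?Z P] =
    (zero_one_mat (concat (map R [1..<r - 1]) @ []) (concat (map C [1..<r - 1]) @ ?Z) P :: 'a mat)"
  proof (rule diag_block_mat_Cons_zero_one_mat)
    show "diag_block_mat [zero_one_mat [] ?Z P] = (zero_one_mat [] ?Z P :: 'a mat)"
      using diag_block_mat_Cons_zero_one_mat[OF empty, of "[]" ?Z] by simp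
    \<comment> \<open>Rows have labels at most \<open>r - 2\<close>, while the columns in
      \<open>?Z\<close> have label \<open>r - 1\<close>.\<close>
    show "\<not> P x y" if xy: "x \<in> set (concat (map R [1..<r - 1]))" "y \<in> set ?Z" for x y
    proof
      assume "P x y"
      from xy(1) obtain k where "k + 1 < r" "x \<in> set (R k)"
        by (auto simp: less_diff_conv)
      then show False
        using R[of k x] Z[OF xy(2)] off[OF \<open>P x y\<close>] by auto
    qed
  qed simp
  have "diag_block_mat [zero_one_mat (R 0) (C 0) P,
      zero_one_mat (concat (map R [1..<r - 1])) (concat (map C [1..<r - 1])) P,
      zero_one_mat [] ?Z P] =
    (zero_one_mat ?rs ?cs P :: 'a mat)"
  proof (rule diag_block_mat_Cons_zero_one_mat)
    show "diag_block_mat [zero_one_mat (concat (map R [1..<r - 1])) (concat (map C [1..<r - 1])) P,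
        zero_one_mat [] ?Z P] =
      (zero_one_mat (concat (map R [1..<r - 1])) (concat (map C [1..<r - 1]) @ ?Z) P :: 'a mat)"
      using tail by simp
    \<comment> \<open>The rows of \<open>R 0\<close> have label 0, and all columns outside
      \<open>C 0\<close> have a positive label.\<close>
    show "\<not> P x y" if x: "x \<in> set (R 0)" and y: "y \<in> set (concat (map C [1..<r - 1]) @ ?Z)" for x y
    proof
      assume "P x y"
      have hx: "x \<in> index_seqs (n - 2) (2 * n)" "h x = 0"
        using R[of 0 x] x r by auto
      from y consider k where "1 \<le> k" "k + 1 < r" "y \<in> set (C k)" | "y \<in> set ?Z"
        by (auto simp: less_diff_conv)
      then have "y \<in> index_seqs n (2 * n) \<and> h y \<noteq> 0"
      proof cases
        case (1 k)
        then show ?thesis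
          using C[of k y] by auto
      next
        case 2
        then show ?thesis
          using Z[of y] r by auto
      qed
      then show False
        using hx off[OF \<open>P x y\<close>] by simp
    qed
    show "\<not> P x y" if x: "x \<in> set (concat (map R [1..<r - 1]))" and y: "y \<in> set (C 0)" for x y
    proof
      assume "P x y"
      from x obtain k where "1 \<le> k" "k + 1 < r" "x \<in> set (R k)"
        by (auto simp: less_diff_conv)
      then show False
        using R[of k x] C[of 0 y] y r off[OF \<open>P x y\<close>] by auto
    qed
  qed
  also have "(zero_one_mat ?rs ?cs P :: 'a mat) = M_mat n ?rs ?cs"
    unfolding M_mat_def P_def ..
  finally have "M_mat n ?rs ?cs = (diag_block_mat [L_mat r,
      direct_sum [1..<r - 1] (\<lambda>k. direct_sum (F k) (\<lambda>a. L_mat (r - k))), 0\<^sub>m 0 (2 ^ n)] :: 'a mat)"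
    unfolding first mid last by simp
  then show ?thesis
    using rs cs unfolding F_def by blast
qed

end
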